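(* Let $\lambda\in(0,\infty)$ and let $p_n=1-e^{-\lambda/n}$ for all natural $n\ge1$. Then $$\mathsf P(X_{n+1,p_{n+1}}\ge m)>\mathsf P(X_{n,p_n}\ge m)$$ for all natural $n\ge1$ and all natural $m\in[2,n+1]$. For $m=1$, this inequality turns into the equality: $\mathsf P(X_{n+1,p_{n+1}}\ge 1)=\mathsf P(X_{n,p_n}\ge 1)$ for all natural $n\ge1$.
   Context: $X_{n,p}$ denotes a random variable having the binomial distribution with parameters $n$ and $p$. *)

theory Defs
  imports "HOL-Probability.Probability"
begin

end

(* Put a = exp (lam / n) - 1 and b = exp (lam / (n + 1)) - 1.  Since (1 - p n) ^ n = exp (- lam), the
   binomial weights are exp (- lam) * (n choose k) * a ^ k and exp (- lam) * (n + 1 choose k) * b ^ k,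
   and the ratio of the second to the first is (b / a) ^ k / (1 - k / (n + 1)).  This ratio is strictly
   log-convex in k and equals 1 at k = 0, so once it has come back to at least 1 it stays above 1.
   The difference of the two weights thus vanishes at 0, then changes sign at most once, from
   negative to positive, and sums to 0; hence its partial sums are negative. *)
theory Submission
  imports Defs
begin

text \<open>The sign of \<open>d (m - 1)\<close> decides. If it is nonnegative, the tail from
  \<open>m\<close> to \<open>N\<close> is positive and the total 0 forces a negative prefix;
  otherwise the prefix has only negative terms after \<open>d 0\<close>. The bounds on
  \<open>m\<close> keep both ranges nonempty.\<close>

lemma sum_lessThan_neg_if_single_crossing:
  fixes d :: "nat \<Rightarrow> real"
  assumes "d 0 = 0" and total: "(\<Sum>k\<le>N. d k) = 0"
    and step: "\<And>k. 1 \<le> k \<Longrightarrow> k < N \<Longrightarrow> 0 \<le> d k \<Longrightarrow> 0 < d (Suc k)"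
    and m: "2 \<le> m" "m \<le> N"
  shows "(\<Sum>k<m. d k) < 0"
proof (cases "0 \<le> d (m - 1)")
  case True
  have pos: "0 < d k" if "m \<le> k" "k \<le> N" for k
    using that
  proof (induction k rule: dec_induct)
    case base
    then show ?case using step[of "m - 1"] True m by auto
  next
    case (step k)
    then show ?case using assms(3)[of k] m by auto
  qed
  have "{..N} = {..<m} \<union> {m..N}" using m by auto
  then have "(\<Sum>k\<le>N. d k) = (\<Sum>k<m. d k) + (\<Sum>k=m..N. d k)"
    by (simp add: sum.union_disjoint ivl_disj_int)
  moreover have "(\<Sum>k=m..N. d k) > 0" using pos m by (intro sum_pos) auto
  ultimately show ?thesis using total by simp
next
  case False
  have neg: "d k < 0" if "k \<le> m - 1" "1 \<le> k" for k
    using that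
  proof (induction k rule: inc_induct)
    case base
    then show ?case using False by simp
  next
    case (step k)
    \<comment> \<open>Contrapositive of the step hypothesis: negativity passes from
      \<open>Suc k\<close> down to \<open>k\<close>.\<close>
    then show ?case using assms(3)[of k] m by force
  qed
  have "{..<m} = insert 0 {1..<m}" using m by auto
  then have "(\<Sum>k<m. d k) = (\<Sum>k=1..<m. d k)" using \<open>d 0 = 0\<close> by simp
  also have "\<dots> < (\<Sum>k=1..<m. 0)" using neg m by (intro sum_strict_mono) auto
  finally show ?thesis by simp
qed

text \<open>The single-crossing step: the convex function \<open>k \<mapsto> t ^ k - (1 - k * s)\<close> vanishes at \<open>0\<close>.\<close>

lemma one_minus_mult_less_power_Suc:
  fixes t s :: real
  assumes "0 < t" "t < 1" "1 \<le> k" and ge: "1 - real k * s \<le> t ^ k"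
  shows "1 - real (Suc k) * s < t ^ Suc k"
proof (rule ccontr)
  assume "\<not> ?thesis"
  \<comment> \<open>So \<open>s\<close> is at most the decrement of \<open>t ^ i\<close> from
    \<open>k\<close> to \<open>Suc k\<close>. Earlier decrements are larger, so their mean over
    \<open>i < k\<close> exceeds \<open>s\<close>, whereas \<open>ge\<close> bounds that mean by
    \<open>s\<close>.\<close>
  then have s: "s \<le> t ^ k * (1 - t)" using ge by (simp add: algebra_simps)
  have "t ^ k \<le> t ^ i" if "i < k" for i
    using that assms by (intro power_decreasing) auto
  moreover have "t ^ k < t ^ 0" using assms by (intro power_strict_decreasing) auto
  ultimately have "(\<Sum>i<k. t ^ k) < (\<Sum>i<k. t ^ i)"
    using \<open>1 \<le> k\<close> by (intro sum_strict_mono_ex1) (auto intro!: bexI[of _ 0])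
  then have "real k * t ^ k * (1 - t) < (1 - t) * (\<Sum>i<k. t ^ i)"
    using \<open>t < 1\<close> by simp
  also have "\<dots> = 1 - t ^ k" by (rule one_diff_power_eq[symmetric])
  also have "\<dots> \<le> real k * s" using ge by simp
  also have "\<dots> \<le> real k * (t ^ k * (1 - t))" using s by (intro mult_left_mono) auto
  finally show False by simp
qed

text \<open>Absorption identity, in product form so as to cover \<open>k = Suc n\<close>, where the
  factor vanishes.\<close>

lemma binomial_eq_fraction_binomial_Suc:
  assumes "k \<le> Suc n"
  shows "real (n choose k) = (1 - real k * (1 / real (Suc n))) * real (Suc n choose k)"
proof -
  have "(Suc n - k) * (Suc n choose k) = Suc n * (n choose k)"
  proof (cases "k = Suc n")
    case False
    then show ?thesis using binomial_absorb_comp[of "Suc n" k] by simp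
  qed simp
  then have "real (Suc n - k) * real (Suc n choose k) = real (Suc n) * real (n choose k)"
    by (metis of_nat_mult)
  then show ?thesis using assms by (simp add: of_nat_diff field_simps)
qed

text \<open>With \<open>q = exp (- lam / n)\<close>, factor out \<open>q ^ n = exp (- lam)\<close>;
  what remains is a power of the odds \<open>(1 - q) / q\<close>. For \<open>k > n\<close> both
  sides are 0.\<close>

lemma pmf_binomial_one_minus_exp:
  assumes "0 < lam" "1 \<le> n"
  shows "pmf (binomial_pmf n (1 - exp (- lam / real n))) k
           = exp (- lam) * real (n choose k) * (exp (lam / real n) - 1) ^ k"
proof (cases "k \<le> n")
  case True
  define q where "q = exp (- lam / real n)"
  have q: "0 < q" "q \<le> 1" using assms by (simp_all add: q_def)
  have "q ^ n = exp (- lam)" using assms by (simp add: q_def exp_of_nat_mult[symmetric])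
  moreover have "exp (lam / real n) = 1 / q" by (simp add: q_def exp_minus field_simps)
  moreover have "(1 - q) ^ k * q ^ (n - k) = q ^ n * (1 / q - 1) ^ k"
  proof -
    have "1 / q - 1 = (1 - q) / q" using q by (simp add: field_simps)
    moreover have "q ^ n = q ^ k * q ^ (n - k)" using True by (simp add: power_add[symmetric])
    ultimately show ?thesis using q by (simp add: power_divide)
  qed
  ultimately show ?thesis
    unfolding q_def[symmetric] using q by (simp add: pmf_binomial mult.assoc)
next
  case False
  then show ?thesis using assms by (simp add: pmf_binomial binomial_eq_0)
qed

lemma prob_pmf_ge:
  fixes q :: "nat pmf"
  shows "measure_pmf.prob q {k. m \<le> k} = 1 - (\<Sum>k<m. pmf q k)"
proof -
  have "{k. m \<le> k} = space (measure_pmf q) - {..<m}" by auto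
  then have "measure_pmf.prob q {k. m \<le> k} = 1 - measure_pmf.prob q {..<m}"
    by (simp only: measure_pmf.prob_compl sets_measure_pmf UNIV_I)
  then show ?thesis by (simp add: measure_measure_pmf_finite)
qed

text \<open>The free bound \<open>N\<close> allows both distributions to be summed over the same
  range.\<close>

lemma sum_pmf_binomial:
  assumes "0 \<le> p" "p \<le> 1" "n \<le> N"
  shows "(\<Sum>k\<le>N. pmf (binomial_pmf n p) k) = 1"
proof (rule sum_pmf_eq_1)
  show "set_pmf (binomial_pmf n p) \<subseteq> {..N}"
    using assms set_pmf_binomial_eq[of p n] by (auto split: if_splits)
qed simp

theorem theorem6:
  fixes lam :: real and p :: "nat \<Rightarrow> real"
  assumes "0 < lam"
    and "\<And>n. n \<ge> 1 \<Longrightarrow> p n = 1 - exp (- lam / real n)"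
  shows "(\<forall>n\<ge>1. \<forall>m\<in>{2..n+1}.
            measure_pmf.prob (binomial_pmf (n+1) (p (n+1))) {k. k \<ge> m}
              > measure_pmf.prob (binomial_pmf n (p n)) {k. k \<ge> m})
       \<and> (\<forall>n\<ge>1.
            measure_pmf.prob (binomial_pmf (n+1) (p (n+1))) {k. k \<ge> 1}
              = measure_pmf.prob (binomial_pmf n (p n)) {k. k \<ge> 1})"
proof (intro conjI allI impI ballI)
  have p: "0 \<le> p n" "p n \<le> 1"
    and weight: "pmf (binomial_pmf n (p n)) k
      = exp (- lam) * real (n choose k) * (exp (lam / real n) - 1) ^ k" if "1 \<le> n" for n k
    using that assms pmf_binomial_one_minus_exp[of lam n k] by simp_all
  fix n :: nat
  assume n: "1 \<le> n"
  show "measure_pmf.prob (binomial_pmf (n+1) (p (n+1))) {k. k \<ge> 1}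
      = measure_pmf.prob (binomial_pmf n (p n)) {k. k \<ge> 1}"
    \<comment> \<open>The complement is the single value 0, whose weight is
      \<open>exp (- lam)\<close> for every \<open>n\<close>.\<close>
    using n by (simp add: prob_pmf_ge weight)
  fix m
  assume m: "m \<in> {2..n+1}"
  define a where "a = exp (lam / real n) - 1"
  define b where "b = exp (lam / real (Suc n)) - 1"
  define t where "t = b / a"
  define s where "s = 1 / real (Suc n)"
  define d where "d = (\<lambda>k. pmf (binomial_pmf (n+1) (p (n+1))) k - pmf (binomial_pmf n (p n)) k)"
  have "0 < b" using assms by (simp add: b_def)
  have "b < a" using assms n by (simp add: a_def b_def frac_less2)
  have t: "0 < t" "t < 1" and a: "0 < a" and b: "b = t * a"
    using \<open>0 < b\<close> \<open>b < a\<close> by (simp_all add: t_def)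
  \<comment> \<open>The factors before the bracket are positive, so \<open>d k\<close> has the sign
    of the bracket.\<close>
  have d_eq: "d k = exp (- lam) * real (Suc n choose k) * a ^ k * (t ^ k - (1 - real k * s))"
    if "k \<le> Suc n" for k
  proof -
    have "d k = exp (- lam) * real (Suc n choose k) * b ^ k - exp (- lam) * real (n choose k) * a ^ k"
      using weight[of n k] weight[of "Suc n" k] n by (simp add: d_def a_def b_def)
    also have "real (n choose k) = (1 - real k * s) * real (Suc n choose k)"
      unfolding s_def using that by (rule binomial_eq_fraction_binomial_Suc)
    finally show ?thesis by (simp only: b power_mult_distrib) (simp only: algebra_simps)
  qed
  have "(\<Sum>k<m. d k) < 0"
  proof (rule sum_lessThan_neg_if_single_crossing[where N = "Suc n"])
    show "d 0 = 0" by (simp add: d_eq)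
    show "(\<Sum>k\<le>Suc n. d k) = 0"
      using p n
      by (simp add: d_def sum_subtractf sum_pmf_binomial del: pmf_binomial sum.atMost_Suc)
    show "0 < d (Suc k)" if "1 \<le> k" "k < Suc n" "0 \<le> d k" for k
    proof -
      have c: "0 < exp (- lam) * real (Suc n choose i) * a ^ i" if "i \<le> Suc n" for i
        using that a by (simp add: zero_less_binomial del: binomial_Suc_Suc)
      have "1 - real k * s \<le> t ^ k"
        using that c[of k] d_eq[of k] zero_le_mult_iff by force
      then have "1 - real (Suc k) * s < t ^ Suc k"
        by (rule one_minus_mult_less_power_Suc[OF t \<open>1 \<le> k\<close>])
      then show ?thesis
        using that c[of "Suc k"] d_eq[of "Suc k"] by (metis Suc_leI diff_gt_0_iff_gt mult_pos_pos)
    qed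
  qed (use m in auto)
  then show "measure_pmf.prob (binomial_pmf n (p n)) {k. k \<ge> m}
      < measure_pmf.prob (binomial_pmf (n+1) (p (n+1))) {k. k \<ge> m}"
    by (simp add: prob_pmf_ge d_def sum_subtractf del: pmf_binomial)
qed

end
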